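(* Let $\mathsf{K},\mathsf{L}$ be kernels on $S$. Then there exists a short-type decomposition of $\mathsf{K}$ with respect to $\mathsf{L}$, that is, a decomposition of $\mathsf{K}$ into a sum of two kernels in which the first summand is $\mathsf{L}$-absolutely continuous and the second one is $\mathsf{L}$-singular. Namely, $$\mathsf{K}=\mathsf{K}_{\mathrm{ac},\mathsf{L}}+\mathsf{K}_{\mathrm{s},\mathsf{L}},$$ where $\mathsf{K}_{\mathrm{ac},\mathsf{L}}$ is the kernel determined by $$\sum_{s,t\in S}\langle f(t),\mathsf{K}_{\mathrm{ac},\mathsf{L}}(s,t)f(s)\rangle=\inf_{g\in\ker\mathfrak{w}_{\mathsf{L}}}\ \sum_{s,t\in S}\langle f(t)-g(t),\mathsf{K}(s,t)(f(s)-g(s))\rangle\qquad(f\in\mathfrak{X}),$$ and $\mathsf{K}_{\mathrm{s},\mathsf{L}}=\mathsf{K}-\mathsf{K}_{\mathrm{ac},\mathsf{L}}$. The short-type decomposition of $\mathsf{K}$ with respect to $\mathsf{L}$ is unique precisely when $\mathsf{K}_{\mathrm{ac},\mathsf{L}}$ is dominated by $\mathsf{L}$.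
   Context: Let $S$ be a non-empty set and $\mathfrak{E}$ a complex Banach space with topological dual $\mathfrak{E}^{*}$. The dual pairing $\langle\cdot,\cdot\rangle:\mathfrak{E}\times\mathfrak{E}^{*}\to\mathbb{C}$ is taken linear in the first and conjugate linear in the second variable (the vector space structure of $\mathfrak{E}^*$ is chosen accordingly). $\mathbf{B}(\mathfrak{E},\mathfrak{E}^{*})$ is the space of bounded linear operators from $\mathfrak{E}$ to $\mathfrak{E}^*$. $\mathfrak{X}$ is the complex linear space of finitely supported functions $f:S\to\mathfrak{E}$. A kernel on $S$ is a function $\mathsf{K}:S\times S\to\mathbf{B}(\mathfrak{E},\mathfrak{E}^{*})$ with $\sum_{s,t\in S}\langle f(t),\mathsf{K}(s,t)f(s)\rangle\ge0$ for all $f\in\mathfrak{X}$. Kernels are added pointwise. A form on $\mathfrak{X}$ is a map $\mathfrak{t}:\mathfrak{X}\times\mathfrak{X}\to\mathbb{C}$, linear in the first and antilinear in the second argument, with $\mathfrak{t}[x]:=\mathfrak{t}(x,x)\ge0$ for all $x$. Put $\ker\mathfrak{t}=\{x:\mathfrak{t}[x]=0\}$, and write $\mathfrak{t}\le\mathfrak{w}$ if $\mathfrak{t}[x]\le\mathfrak{w}[x]$ for all $x$. For forms: $\mathfrak{t}$ is dominated by $\mathfrak{w}$ if $\mathfrak{t}\le c\,\mathfrak{w}$ for some constant $c$; $\mathfrak{t}$ is $\mathfrak{w}$-absolutely continuous if $\mathfrak{w}[x]=0$ implies $\mathfrak{t}[x]=0$; $\mathfrak{t}$ and $\mathfrak{w}$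 are singular (also: $\mathfrak{t}$ is $\mathfrak{w}$-singular) if the only form $\mathfrak{s}$ with $\mathfrak{s}\le\mathfrak{t}$ and $\mathfrak{s}\le\mathfrak{w}$ is $\mathfrak{s}=0$. The form associated with a kernel $\mathsf{K}$ is $\mathfrak{w}_{\mathsf{K}}(f,g)=\sum_{s,t\in S}\langle f(t),\mathsf{K}(s,t)g(s)\rangle$. Domination, absolute continuity and singularity of kernels mean the corresponding property of their associated forms. *)

theory Defs
  imports "HOL-Analysis.Analysis" "HOL-Library.Poly_Mapping"
begin

class complex_vector = ab_group_add +
  fixes scaleC :: "complex \<Rightarrow> 'a \<Rightarrow> 'a"  (infixr \<open>*\<^sub>C\<close> 75)
  assumes scaleC_add_right: "c *\<^sub>C (x + y) = c *\<^sub>C x + c *\<^sub>C y"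
    and scaleC_add_left: "(c + d) *\<^sub>C x = c *\<^sub>C x + d *\<^sub>C x"
    and scaleC_scaleC: "c *\<^sub>C d *\<^sub>C x = (c * d) *\<^sub>C x"
    and scaleC_one: "1 *\<^sub>C x = x"

lemma scaleC_zero_right [simp]: "c *\<^sub>C (0 :: 'a::complex_vector) = 0"
  using scaleC_add_right[of c "0::'a" 0] by simp

class complex_banach = complex_vector + banach +
  assumes scaleC_of_real: "complex_of_real r *\<^sub>C x = r *\<^sub>R x"
    and norm_scaleC: "norm (c *\<^sub>C x) = cmod c * norm x"

text \<open>
  The finitely supported functions from the (nonempty) type \<open>'s\<close> to \<open>'a\<close>, i.e. the
  type \<open>'s \<Rightarrow>\<^sub>0 'a\<close>, form a complex vector space with the pointwise operations.
\<close>

instantiation poly_mapping :: (type, complex_vector) complex_vector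
begin

lift_definition scaleC_poly_mapping :: "complex \<Rightarrow> ('a \<Rightarrow>\<^sub>0 'b) \<Rightarrow> ('a \<Rightarrow>\<^sub>0 'b)"
  is "\<lambda>c f s. c *\<^sub>C f s"
  by (erule finite_subset[rotated]) auto

instance
  by standard
    (transfer, simp add: fun_eq_iff scaleC_add_right scaleC_add_left scaleC_scaleC scaleC_one)+

end

text \<open>
  Elements of the dual are complex linear functionals, so that the pairing is linear in its
  first variable. Scalars act on the dual by \<open>\<langle>x, c \<phi>\<rangle> = cnj c * \<langle>x, \<phi>\<rangle>\<close>, which makes the
  pairing conjugate linear in its second variable.
\<close>

definition topological_dual :: "('a::complex_banach \<Rightarrow>\<^sub>L complex) set" where
  "topological_dual = {\<phi>. \<forall>c x. blinfun_apply \<phi> (c *\<^sub>C x) = c * blinfun_apply \<phi> x}"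

definition dual_scale ::
    "complex \<Rightarrow> ('a::complex_banach \<Rightarrow>\<^sub>L complex) \<Rightarrow> ('a \<Rightarrow>\<^sub>L complex)" where
  "dual_scale c \<phi> = blinfun_mult_right (cnj c) o\<^sub>L \<phi>"

definition pairing :: "'a::complex_banach \<Rightarrow> ('a \<Rightarrow>\<^sub>L complex) \<Rightarrow> complex" where
  "pairing x \<phi> = blinfun_apply \<phi> x"

lemma pairing_dual_scale: "pairing x (dual_scale c \<phi>) = cnj c * pairing x \<phi>"
  by (simp add: pairing_def dual_scale_def blinfun_mult_right.rep_eq)

definition dual_operators :: "('a::complex_banach \<Rightarrow>\<^sub>L 'a \<Rightarrow>\<^sub>L complex) set" where
  "dual_operators = {T. (\<forall>x. blinfun_apply T x \<in> topological_dual) \<and>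
     (\<forall>c x. blinfun_apply T (c *\<^sub>C x) = dual_scale c (blinfun_apply T x))}"

type_synonym 'v form = "'v \<Rightarrow> 'v \<Rightarrow> complex"

definition is_form :: "'v::complex_vector form \<Rightarrow> bool" where
  "is_form t \<longleftrightarrow>
     (\<forall>x y z. t (x + y) z = t x z + t y z) \<and>
     (\<forall>c x z. t (c *\<^sub>C x) z = c * t x z) \<and>
     (\<forall>x y z. t x (y + z) = t x y + t x z) \<and>
     (\<forall>c x z. t x (c *\<^sub>C z) = cnj c * t x z) \<and>
     (\<forall>x. t x x \<in> \<real>\<^sub>\<ge>\<^sub>0)"

text \<open>For a form, \<open>t x x\<close> is a nonnegative real, so that taking the real part only
  changes the type.\<close>

definition quad :: "'v form \<Rightarrow> 'v \<Rightarrow> real" where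
  "quad t x = Re (t x x)"

definition form_ker :: "'v form \<Rightarrow> 'v set" where
  "form_ker t = {x. quad t x = 0}"

definition form_le :: "'v form \<Rightarrow> 'v form \<Rightarrow> bool" where
  "form_le t w \<longleftrightarrow> (\<forall>x. quad t x \<le> quad w x)"

definition form_dominated :: "'v form \<Rightarrow> 'v form \<Rightarrow> bool" where
  "form_dominated t w \<longleftrightarrow> (\<exists>c::real. \<forall>x. quad t x \<le> c * quad w x)"

definition form_absolutely_continuous :: "'v form \<Rightarrow> 'v form \<Rightarrow> bool" where
  "form_absolutely_continuous t w \<longleftrightarrow> (\<forall>x. quad w x = 0 \<longrightarrow> quad t x = 0)"

definition form_singular :: "'v::complex_vector form \<Rightarrow> 'v form \<Rightarrow> bool" where
  "form_singular t w \<longleftrightarrow>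
     (\<forall>s. is_form s \<and> form_le s t \<and> form_le s w \<longrightarrow> s = (\<lambda>x y. 0))"

type_synonym ('s, 'e) operator_function = "'s \<Rightarrow> 's \<Rightarrow> ('e \<Rightarrow>\<^sub>L 'e \<Rightarrow>\<^sub>L complex)"

text \<open>The sums over all of \<open>'s\<close> are restricted to the supports, outside of which the
  summands vanish.\<close>

definition kernel_form ::
    "('s, 'e::complex_banach) operator_function \<Rightarrow> ('s \<Rightarrow>\<^sub>0 'e) form" where
  "kernel_form K f g =
     (\<Sum>s\<in>Poly_Mapping.keys g. \<Sum>t\<in>Poly_Mapping.keys f.
        pairing (Poly_Mapping.lookup f t) (blinfun_apply (K s t) (Poly_Mapping.lookup g s)))"

definition is_kernel :: "('s, 'e::complex_banach) operator_function \<Rightarrow> bool" where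
  "is_kernel K \<longleftrightarrow> (\<forall>s t. K s t \<in> dual_operators) \<and> (\<forall>f. kernel_form K f f \<in> \<real>\<^sub>\<ge>\<^sub>0)"

definition kernel_dominated ::
    "('s, 'e::complex_banach) operator_function \<Rightarrow> ('s, 'e) operator_function \<Rightarrow> bool" where
  "kernel_dominated K L \<longleftrightarrow> form_dominated (kernel_form K) (kernel_form L)"

definition kernel_absolutely_continuous ::
    "('s, 'e::complex_banach) operator_function \<Rightarrow> ('s, 'e) operator_function \<Rightarrow> bool" where
  "kernel_absolutely_continuous K L \<longleftrightarrow>
     form_absolutely_continuous (kernel_form K) (kernel_form L)"

definition kernel_singular ::
    "('s, 'e::complex_banach) operator_function \<Rightarrow> ('s, 'e) operator_function \<Rightarrow> bool" where
  "kernel_singular K L \<longleftrightarrow> form_singular (kernel_form K) (kernel_form L)"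

definition short_type_decomposition ::
    "('s, 'e::complex_banach) operator_function \<Rightarrow> ('s, 'e) operator_function \<Rightarrow>
     ('s, 'e) operator_function \<Rightarrow> ('s, 'e) operator_function \<Rightarrow> bool" where
  "short_type_decomposition K L A B \<longleftrightarrow>
     is_kernel A \<and> is_kernel B \<and> (\<forall>s t. K s t = A s t + B s t) \<and>
     kernel_absolutely_continuous A L \<and> kernel_singular B L"

definition determines_ac_part ::
    "('s, 'e::complex_banach) operator_function \<Rightarrow> ('s, 'e) operator_function \<Rightarrow>
     ('s, 'e) operator_function \<Rightarrow> bool" where
  "determines_ac_part K L A \<longleftrightarrow> is_kernel A \<and>
     (\<forall>f. quad (kernel_form A) f =
            (INF g\<in>form_ker (kernel_form L). quad (kernel_form K) (f - g)))"

definition ac_part ::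
    "('s, 'e::complex_banach) operator_function \<Rightarrow> ('s, 'e) operator_function \<Rightarrow>
     ('s, 'e) operator_function" where
  "ac_part K L = (THE A. determines_ac_part K L A)"

definition singular_part ::
    "('s, 'e::complex_banach) operator_function \<Rightarrow> ('s, 'e) operator_function \<Rightarrow>
     ('s, 'e) operator_function" where
  "singular_part K L = (\<lambda>s t. K s t - ac_part K L s t)"

end

theory Submission
  imports Defs
begin

text \<open>
  Write \<open>t\<close> and \<open>w\<close> for the forms of the kernels \<open>K\<close> and \<open>L\<close>, and \<open>u\<close> for the
  short form, \<open>quad u x = (INF g\<in>ker w. quad t (x - g))\<close>. A form vanishing on \<open>ker w\<close> is
  constant along \<open>x + ker w\<close>, so \<open>u\<close> is the largest \<open>w\<close>-absolutely continuous form below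
  \<open>t\<close>. For the same reason \<open>s \<le> t - u + v\<close> implies \<open>s \<le> v\<close> when \<open>s \<le> w\<close> and \<open>v\<close> is
  \<open>w\<close>-absolutely continuous; \<open>v = 0\<close> gives singularity of \<open>t - u\<close>. Every form below a
  kernel form is a kernel form, by the Cauchy-Schwarz inequality.

  If \<open>u\<close> is dominated by \<open>w\<close> and \<open>t = a + b\<close> is another decomposition, then \<open>a \<le> u\<close>, and a
  small multiple of \<open>u - a\<close> lies below both \<open>b\<close> and \<open>w\<close>, so \<open>a = u\<close>. If \<open>u\<close> is not
  dominated by \<open>w\<close>, there is a linear functional \<open>\<phi>\<close> with \<open>\<bar>\<phi>\<bar>\<^sup>2 \<le> u\<close> that is not
  \<open>w\<close>-bounded. A form below both \<open>\<bar>\<phi>\<bar>\<^sup>2\<close> and \<open>w\<close> is then a multiple of \<open>\<bar>\<phi>\<bar>\<^sup>2\<close>, hence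
  zero, and the \<open>v = \<bar>\<phi>\<bar>\<^sup>2\<close> case of the implication above makes
  \<open>(u - \<bar>\<phi>\<bar>\<^sup>2) + (t - u + \<bar>\<phi>\<bar>\<^sup>2)\<close> a second decomposition.
\<close>

lemma scaleC_minus_one: "(- 1) *\<^sub>C x = - (x :: 'v::complex_vector)"
proof -
  have "(0::complex) *\<^sub>C x = 0"
    using scaleC_add_left[of 0 0 x] by simp
  then have "x + (- 1) *\<^sub>C x = 0"
    using scaleC_add_left[of 1 "- 1" x] by (simp add: scaleC_one)
  then show ?thesis
    by (simp add: eq_neg_iff_add_eq_0 add.commute)
qed

section \<open>Forms\<close>

locale nonneg_form =
  fixes t :: "'v::complex_vector form"
  assumes is_form: "is_form t"
begin

lemma add_left: "t (x + y) z = t x z + t y z"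
  and scaleC_left: "t (c *\<^sub>C x) z = c * t x z"
  and add_right: "t x (y + z) = t x y + t x z"
  and scaleC_right: "t x (c *\<^sub>C z) = cnj c * t x z"
  and nonneg: "t x x \<in> \<real>\<^sub>\<ge>\<^sub>0"
  using is_form by (auto simp: is_form_def)

lemma minus_left: "t (- x) z = - t x z"
  using scaleC_left[of "- 1" x z] by (simp add: scaleC_minus_one)

lemma minus_right: "t x (- z) = - t x z"
  using scaleC_right[of x "- 1" z] by (simp add: scaleC_minus_one)

lemma diff_left: "t (x - y) z = t x z - t y z"
  using add_left[of x "- y" z] by (simp add: minus_left)

lemma diff_right: "t x (y - z) = t x y - t x z"
  using add_right[of x y "- z"] by (simp add: minus_right)

lemma zero_left: "t 0 z = 0"
  using add_left[of 0 0 z] by simp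

lemma zero_right: "t x 0 = 0"
  using add_right[of x 0 0] by simp

lemma sum_left: "t (\<Sum>i\<in>I. f i) z = (\<Sum>i\<in>I. t (f i) z)"
  by (induction I rule: infinite_finite_induct) (auto simp: zero_left add_left)

lemma sum_right: "t x (\<Sum>i\<in>I. f i) = (\<Sum>i\<in>I. t x (f i))"
  by (induction I rule: infinite_finite_induct) (auto simp: zero_right add_right)

lemma quad_nonneg: "quad t x \<ge> 0"
  using nonneg[of x] by (simp add: quad_def complex_nonneg_Reals_iff)

lemma self_eq_quad: "t x x = of_real (quad t x)"
  using nonneg[of x] by (simp add: quad_def complex_nonneg_Reals_iff complex_eq_iff)

text \<open>Polarization: the diagonal values at x + y and x + i y are real, which controls the
  imaginary and the real part respectively.\<close>

lemma hermitian: "t y x = cnj (t x y)"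
proof -
  have im: "Im (t z z) = 0" for z
    using nonneg[of z] by (simp add: complex_nonneg_Reals_iff)
  have "Im (t x y) + Im (t y x) = 0"
    using im[of "x + y"] im[of x] im[of y] by (simp add: add_left add_right)
  moreover have "Re (t y x) - Re (t x y) = 0"
    using im[of "x + \<i> *\<^sub>C y"] im[of x] im[of y]
    by (simp add: add_left add_right scaleC_left scaleC_right)
  ultimately show ?thesis
    by (simp add: complex_eq_iff)
qed

lemma quad_add: "quad t (x + y) = quad t x + 2 * Re (t x y) + quad t y"
  by (simp add: quad_def add_left add_right hermitian[of y x])

lemma quad_diff: "quad t (x - y) = quad t x - 2 * Re (t x y) + quad t y"
  by (simp add: quad_def diff_left diff_right hermitian[of y x])

lemma quad_scaleC: "quad t (c *\<^sub>C x) = (cmod c)\<^sup>2 * quad t x"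
proof -
  have "t (c *\<^sub>C x) (c *\<^sub>C x) = (c * cnj c) * t x x"
    by (simp add: scaleC_left scaleC_right)
  then show ?thesis
    by (simp add: quad_def complex_mult_cnj cmod_power2)
qed

lemma quad_add_scaleC:
  "quad t (x + c *\<^sub>C y) = quad t x + 2 * Re (cnj c * t x y) + (cmod c)\<^sup>2 * quad t y"
  by (simp add: quad_add quad_scaleC scaleC_right)

end

text \<open>Completing the square. With \<open>A\<close>, \<open>z\<close>, \<open>B\<close> not
  tied to a form, it serves both the Cauchy-Schwarz inequality and near-minimisers, where
  \<open>A\<close> is only the excess over an infimum.\<close>

lemma discriminant_bound:
  fixes z :: complex
  assumes "\<And>c. 0 \<le> A + 2 * Re (cnj c * z) + (cmod c)\<^sup>2 * B" and "0 \<le> B"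
  shows "(cmod z)\<^sup>2 \<le> A * B"
proof -
  have zz: "Re (cnj z * z) = (cmod z)\<^sup>2"
    by (simp add: cmod_power2) (simp add: power2_eq_square)
  show ?thesis
  proof (cases "B = 0")
    case True
    \<comment> \<open>With \<open>B = 0\<close> and c = -s z the assumption is affine in
      \<open>s\<close>; the value of \<open>s\<close> used below makes it -1 unless
      \<open>z = 0\<close>.\<close>
    have "0 \<le> A - 2 * s * (cmod z)\<^sup>2" for s
    proof -
      have "Re (cnj (of_real (- s) * z) * z) = - s * Re (cnj z * z)"
        by (simp add: algebra_simps)
      then show ?thesis
        using assms(1)[of "of_real (- s) * z"] True unfolding zz by simp
    qed
    from this[of "(A + 1) / (2 * (cmod z)\<^sup>2)"] have "z = 0"
      by (cases "z = 0") auto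
    with True show ?thesis
      by simp
  next
    case False
    with assms have B: "B > 0"
      by simp
    \<comment> \<open>The minimiser of the quadratic expression in \<open>c\<close>.\<close>
    define c where "c = of_real (- 1 / B) * z"
    have "Re (cnj c * z) = (- 1 / B) * Re (cnj z * z)"
      by (simp add: c_def)
    moreover have "(cmod c)\<^sup>2 = (cmod z)\<^sup>2 / B\<^sup>2"
      using B by (simp add: c_def norm_mult norm_divide power_divide)
    ultimately have "0 \<le> A - 2 * (cmod z)\<^sup>2 / B + (cmod z)\<^sup>2 / B\<^sup>2 * B"
      using assms(1)[of c] unfolding zz by simp
    also have "\<dots> = A - (cmod z)\<^sup>2 / B"
      using B by (simp add: field_simps power2_eq_square)
    finally show ?thesis
      using B by (simp add: field_simps)
  qed
qed

context nonneg_form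
begin

lemma Cauchy_Schwarz: "(cmod (t x y))\<^sup>2 \<le> quad t x * quad t y"
  using quad_nonneg[of "x + _ *\<^sub>C y"] quad_nonneg
  by (intro discriminant_bound) (auto simp: quad_add_scaleC)

lemma null_left: "quad t x = 0 \<Longrightarrow> t x y = 0"
  using Cauchy_Schwarz[of x y] by simp

lemma null_right: "quad t y = 0 \<Longrightarrow> t x y = 0"
  using Cauchy_Schwarz[of x y] by simp

lemma quad_diff_null: "quad t g = 0 \<Longrightarrow> quad t (x - g) = quad t x"
  by (simp add: quad_diff null_right)

lemma null_add: "quad t x = 0 \<Longrightarrow> quad t y = 0 \<Longrightarrow> quad t (x + y) = 0"
  by (simp add: quad_add null_left)

lemma null_scaleC: "quad t x = 0 \<Longrightarrow> quad t (c *\<^sub>C x) = 0"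
  by (simp add: quad_scaleC)

lemma eq_zeroI: "(\<And>x. quad t x = 0) \<Longrightarrow> t = (\<lambda>x y. 0)"
  by (simp add: fun_eq_iff null_left)

end

text \<open>Polarization. The infimum formula prescribes only the diagonal of a form, and this is
  why it determines the form.\<close>

lemma form_eqI:
  assumes "is_form t" and "is_form u" and "\<And>x. quad t x = quad u x"
  shows "t = u"
proof -
  interpret t: nonneg_form t by unfold_locales fact
  interpret u: nonneg_form u by unfold_locales fact
  have re: "Re (t x y) = Re (u x y)" for x y
    using assms(3)[of "x + y"] assms(3)[of x] assms(3)[of y]
    by (simp add: t.quad_add u.quad_add)
  have "Im (t x y) = Im (u x y)" for x y
    using re[of x "\<i> *\<^sub>C y"] by (simp add: t.scaleC_right u.scaleC_right)
  with re show ?thesis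
    by (simp add: fun_eq_iff complex_eq_iff)
qed

lemma is_form_diff:
  assumes "is_form t" and "is_form u" and "form_le u t"
  shows "is_form (\<lambda>x y. t x y - u x y)"
proof -
  interpret t: nonneg_form t by unfold_locales fact
  interpret u: nonneg_form u by unfold_locales fact
  have "t x x - u x x \<in> \<real>\<^sub>\<ge>\<^sub>0" for x
    using assms(3) unfolding t.self_eq_quad u.self_eq_quad form_le_def
    by (simp flip: of_real_diff)
  then show ?thesis
    unfolding is_form_def
    by (auto simp: t.add_left u.add_left t.add_right u.add_right t.scaleC_left u.scaleC_left
        t.scaleC_right u.scaleC_right algebra_simps)
qed

lemma quad_diff_form: "quad (\<lambda>x y. t x y - u x y) x = quad t x - quad u x"
  by (simp add: quad_def)

lemma is_form_scale:
  assumes "is_form t" and "0 \<le> r"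
  shows "is_form (\<lambda>x y. of_real r * t x y)"
proof -
  interpret nonneg_form t by unfold_locales fact
  show ?thesis
    using assms(2) unfolding is_form_def
    by (auto simp: add_left add_right scaleC_left scaleC_right algebra_simps
        intro!: nonneg_Reals_mult_I nonneg)
qed

section \<open>The short form\<close>

text \<open>
  The infimum need not be attained. If \<open>r n \<in> x + ker w\<close> is a minimising sequence, then
  \<open>t (r n) g\<close> tends to zero for \<open>g \<in> ker w\<close>, uniformly on bounded sets. Hence
  \<open>t (r n) y\<close> converges, and its limit is the desired form: it is antilinear in \<open>y\<close> and
  Hermitian.
\<close>

lemma short_form_exists:
  fixes t w :: "'v::complex_vector form"
  assumes "is_form t" and "is_form w"
  shows "\<exists>u. is_form u \<and> (\<forall>x. quad u x = (INF g\<in>form_ker w. quad t (x - g)))"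
proof -
  interpret t: nonneg_form t by unfold_locales fact
  interpret w: nonneg_form w by unfold_locales fact
  let ?M = "form_ker w"
  have M0: "0 \<in> ?M"
    by (simp add: form_ker_def quad_def w.zero_left)
  have Madd: "g + h \<in> ?M" if "g \<in> ?M" "h \<in> ?M" for g h
    using that by (simp add: form_ker_def w.null_add)
  have Mscale: "c *\<^sub>C g \<in> ?M" if "g \<in> ?M" for c g
    using that by (simp add: form_ker_def w.null_scaleC)
  have Mdiff: "g - h \<in> ?M" if "g \<in> ?M" "h \<in> ?M" for g h
    using Madd[OF that(1) Mscale[OF that(2), of "- 1"]] by (simp add: scaleC_minus_one)
  define q where "q x = (INF g\<in>?M. quad t (x - g))" for x
  have bdd: "bdd_below ((\<lambda>g. quad t (x - g)) ` ?M)" for x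
    by (intro bdd_belowI[of _ 0]) (auto intro: t.quad_nonneg)
  have q_le: "q x \<le> quad t (x - g)" if "g \<in> ?M" for x g
    unfolding q_def using that bdd by (intro cINF_lower) auto
  have q_nonneg: "0 \<le> q x" for x
    unfolding q_def using M0 t.quad_nonneg by (intro cINF_greatest) auto
  define e where "e n = 1 / real (Suc n)" for n
  have e_pos: "e n > 0" for n
    by (simp add: e_def)
  have e_lim: "e \<longlonglongrightarrow> 0"
    unfolding e_def using LIMSEQ_inverse_real_of_nat by (simp add: inverse_eq_divide)
  \<comment> \<open>The slack is squared because the bound in \<open>orth\<close> takes its square
    root.\<close>
  have "\<exists>g\<in>?M. quad t (x - g) < q x + (e n)\<^sup>2" for x n
    using M0 bdd e_pos[of n] unfolding q_def
    by (subst cINF_less_iff[symmetric]) auto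
  then obtain P where P: "\<And>x n. P x n \<in> ?M" "\<And>x n. quad t (x - P x n) < q x + (e n)\<^sup>2"
    by metis
  define r where "r x n = x - P x n" for x n
  \<comment> \<open>Moving \<open>r x n\<close> by multiples of \<open>g\<close> stays in x + ker w,
    so it lowers \<open>quad t\<close> by less than the slack \<open>(e n)\<^sup>2\<close>; this is
    the discriminant condition.\<close>
  have orth: "cmod (t (r x n) g) \<le> e n * sqrt (quad t g)" if "g \<in> ?M" for x n g
  proof -
    have "(cmod (t (r x n) g))\<^sup>2 \<le> (quad t (r x n) - q x) * quad t g"
    proof (rule discriminant_bound)
      fix c
      have "q x \<le> quad t (r x n + c *\<^sub>C g)"
        using q_le[OF Mdiff[OF P(1)[of x n] Mscale[OF that, of c]], of x]
        by (simp add: r_def algebra_simps)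
      then show "0 \<le> quad t (r x n) - q x + 2 * Re (cnj c * t (r x n) g) + (cmod c)\<^sup>2 * quad t g"
        by (simp add: t.quad_add_scaleC)
    qed (rule t.quad_nonneg)
    also have "\<dots> \<le> (e n)\<^sup>2 * quad t g"
      using P(2)[of x n] t.quad_nonneg[of g] by (intro mult_right_mono) (auto simp: r_def)
    also have "\<dots> = (e n * sqrt (quad t g))\<^sup>2"
      by (simp add: power_mult_distrib t.quad_nonneg)
    finally show ?thesis
      using e_pos[of n] by (simp add: abs_le_square_iff[symmetric] t.quad_nonneg power2_le_iff_abs_le)
  qed
  have r_diff: "r x n - r x m \<in> ?M" for x n m
    using Mdiff[OF P(1)[of x m] P(1)[of x n]] by (simp add: r_def)
  \<comment> \<open>Apply \<open>orth\<close> to the difference itself, which lies in ker w, and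
    cancel one factor.\<close>
  have close: "sqrt (quad t (r x n - r x m)) \<le> e n + e m" for x n m
  proof -
    let ?d = "r x n - r x m"
    have "quad t ?d = Re (t (r x n) ?d - t (r x m) ?d)"
      by (simp add: quad_def t.diff_left)
    also have "\<dots> \<le> cmod (t (r x n) ?d) + cmod (t (r x m) ?d)"
      by (rule order_trans[OF complex_Re_le_cmod norm_triangle_ineq4])
    also have "\<dots> \<le> (e n + e m) * sqrt (quad t ?d)"
      using orth[OF r_diff[of x n m], of x n] orth[OF r_diff[of x n m], of x m]
      by (simp add: distrib_right)
    finally have "sqrt (quad t ?d) * sqrt (quad t ?d) \<le> (e n + e m) * sqrt (quad t ?d)"
      by (simp add: t.quad_nonneg)
    from mult_right_le_imp_le[OF this] show ?thesis
      using e_pos[of n] e_pos[of m] t.quad_nonneg[of ?d]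
      by (cases "quad t ?d = 0") auto
  qed
  have "convergent (\<lambda>n. t (r x n) y)" for x y
  proof (rule Cauchy_convergent, rule metric_CauchyI)
    fix \<epsilon> :: real assume "\<epsilon> > 0"
    \<comment> \<open>Adding 1 keeps the divisor positive when \<open>quad t y = 0\<close>.\<close>
    let ?s = "sqrt (quad t y) + 1"
    have s: "?s > 0"
      by (simp add: add_nonneg_pos t.quad_nonneg)
    have "\<forall>\<^sub>F n in sequentially. e n < \<epsilon> / (2 * ?s)"
      using e_lim \<open>\<epsilon> > 0\<close> s by (intro order_tendstoD) auto
    then obtain N where N: "\<And>n. n \<ge> N \<Longrightarrow> e n < \<epsilon> / (2 * ?s)"
      by (auto simp: eventually_sequentially)
    have "dist (t (r x n) y) (t (r x m) y) < \<epsilon>" if "n \<ge> N" "m \<ge> N" for n m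
    proof -
      have "(cmod (t (r x n - r x m) y))\<^sup>2 \<le> quad t (r x n - r x m) * quad t y"
        by (rule t.Cauchy_Schwarz)
      then have "cmod (t (r x n - r x m) y) \<le> sqrt (quad t (r x n - r x m)) * sqrt (quad t y)"
        by (simp add: real_le_rsqrt flip: real_sqrt_mult)
      also have "\<dots> \<le> (e n + e m) * sqrt (quad t y)"
        by (intro mult_right_mono close) (simp add: t.quad_nonneg)
      also have "\<dots> \<le> (e n + e m) * ?s"
        using e_pos[of n] e_pos[of m] by (intro mult_left_mono) auto
      also have "\<dots> < (\<epsilon> / (2 * ?s) + \<epsilon> / (2 * ?s)) * ?s"
        using N[OF that(1)] N[OF that(2)] s by (intro mult_strict_right_mono add_strict_mono)
      also have "\<dots> = \<epsilon>"
      proof -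
        have "(\<epsilon> / (2 * S) + \<epsilon> / (2 * S)) * S = \<epsilon>" if "S > 0" for S :: real
          using that by (simp add: field_simps)
        then show ?thesis
          using s by blast
      qed
      finally show ?thesis
        by (simp add: dist_norm t.diff_left)
    qed
    then show "\<exists>M. \<forall>m\<ge>M. \<forall>n\<ge>M. dist (t (r x m) y) (t (r x n) y) < \<epsilon>"
      by blast
  qed
  then obtain u where u: "\<And>x y. (\<lambda>n. t (r x n) y) \<longlonglongrightarrow> u x y"
    unfolding convergent_def by metis
  \<comment> \<open>This lets \<open>r y n\<close> replace \<open>y\<close> in the limit.
    \<open>P y n\<close> stays bounded by the parallelogram law for \<open>y\<close> and
    \<open>r y n\<close>, while \<open>orth\<close> supplies the factor \<open>e n\<close>.\<close>
  have P_small: "(\<lambda>n. t (r x n) (P y n)) \<longlonglongrightarrow> 0" for x y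
  proof (rule Lim_null_comparison)
    let ?b = "sqrt (2 * (q y + 1) + 2 * quad t y)"
    have "quad t (P y n) \<le> 2 * (q y + 1) + 2 * quad t y" for n
    proof -
      have "quad t (y + r y n) + quad t (P y n) = 2 * quad t (r y n) + 2 * quad t y"
        using t.quad_diff[of y "r y n"] by (simp add: t.quad_add) (simp add: r_def)
      moreover have "(e n)\<^sup>2 \<le> 1"
        by (simp add: e_def power_le_one)
      ultimately show ?thesis
        using P(2)[of y n] t.quad_nonneg[of "y + r y n"] by (simp add: r_def)
    qed
    then have "cmod (t (r x n) (P y n)) \<le> e n * ?b" for n
      using orth[OF P(1), of x n y n] e_pos[of n]
      by (intro order_trans[OF orth[OF P(1)]] mult_left_mono real_sqrt_le_mono) auto
    then show "\<forall>\<^sub>F n in sequentially. cmod (t (r x n) (P y n)) \<le> e n * ?b"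
      by simp
    show "(\<lambda>n. e n * ?b) \<longlonglongrightarrow> 0"
      using tendsto_mult_right[OF e_lim, of ?b] by simp
  qed
  \<comment> \<open>The choice of \<open>r x n\<close> need not be linear in \<open>x\<close>, so
    linearity of \<open>u\<close> in its first argument comes from Hermitian symmetry, visible in
    this symmetric expression; \<open>diag\<close> uses it as well.\<close>
  have u_alt: "(\<lambda>n. t (r x n) (r y n)) \<longlonglongrightarrow> u x y" for x y
    using tendsto_diff[OF u[of x y] P_small[of x y]] by (simp add: r_def t.diff_right)
  have herm: "u y x = cnj (u x y)" for x y
  proof (rule LIMSEQ_unique[OF u_alt])
    show "(\<lambda>n. t (r y n) (r x n)) \<longlonglongrightarrow> cnj (u x y)"
      using tendsto_cnj[OF u_alt[of x y]] by (simp flip: t.hermitian)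
  qed
  have add_r: "u x (y + z) = u x y + u x z" for x y z
  proof (rule LIMSEQ_unique[OF u])
    show "(\<lambda>n. t (r x n) (y + z)) \<longlonglongrightarrow> u x y + u x z"
      unfolding t.add_right by (intro tendsto_add u)
  qed
  have scale_r: "u x (c *\<^sub>C y) = cnj c * u x y" for x y c
  proof (rule LIMSEQ_unique[OF u])
    show "(\<lambda>n. t (r x n) (c *\<^sub>C y)) \<longlonglongrightarrow> cnj c * u x y"
      unfolding t.scaleC_right by (intro tendsto_mult_left u)
  qed
  have diag: "u x x = of_real (q x)" for x
  proof (rule LIMSEQ_unique[OF u_alt])
    have "(\<lambda>n. quad t (r x n)) \<longlonglongrightarrow> q x"
    proof (rule tendsto_sandwich)
      show "(\<lambda>n. q x) \<longlonglongrightarrow> q x" by simp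
      show "(\<lambda>n. q x + (e n)\<^sup>2) \<longlonglongrightarrow> q x"
        using tendsto_add[OF tendsto_const tendsto_power[OF e_lim, of 2], of "q x"] by simp
      show "\<forall>\<^sub>F n in sequentially. q x \<le> quad t (r x n)"
        by (simp add: r_def q_le P(1))
      show "\<forall>\<^sub>F n in sequentially. quad t (r x n) \<le> q x + (e n)\<^sup>2"
        using P(2) by (simp add: r_def less_imp_le)
    qed
    then show "(\<lambda>n. t (r x n) (r x n)) \<longlonglongrightarrow> of_real (q x)"
      unfolding t.self_eq_quad by (rule tendsto_of_real)
  qed
  have "is_form u"
    unfolding is_form_def
  proof (intro conjI allI)
    show "u (x + y) z = u x z + u y z" for x y z
      using herm[of "x + y" z] herm[of x z] herm[of y z] add_r[of z x y] by simp
    show "u (c *\<^sub>C x) z = c * u x z" for c x z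
      using herm[of "c *\<^sub>C x" z] herm[of x z] scale_r[of z c x] by simp
    show "u x x \<in> \<real>\<^sub>\<ge>\<^sub>0" for x
      by (simp add: diag q_nonneg)
  qed (simp_all add: add_r scale_r)
  moreover have "quad u x = q x" for x
    by (simp add: quad_def diag)
  ultimately show ?thesis
    unfolding q_def by blast
qed

section \<open>Extremal properties of the short form\<close>

locale short_form = t: nonneg_form t + w: nonneg_form w + u: nonneg_form u
  for t w u :: "'v::complex_vector form" +
  assumes quad_short: "quad u x = (INF g\<in>form_ker w. quad t (x - g))"
begin

lemma short_le_translate: "quad w g = 0 \<Longrightarrow> quad u x \<le> quad t (x - g)"
  unfolding quad_short
  by (intro cINF_lower bdd_belowI[of _ 0]) (auto simp: form_ker_def t.quad_nonneg)

lemma short_greatest: "(\<And>g. quad w g = 0 \<Longrightarrow> b \<le> quad t (x - g)) \<Longrightarrow> b \<le> quad u x"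
  unfolding quad_short
  by (rule cINF_greatest) (auto simp: form_ker_def intro!: exI[of _ 0] simp: quad_def w.zero_left)

lemma short_le: "form_le u t"
  using short_le_translate[of 0] by (simp add: form_le_def quad_def w.zero_left)

lemma short_absolutely_continuous: "form_absolutely_continuous u w"
  unfolding form_absolutely_continuous_def
proof (intro allI impI)
  fix x assume "quad w x = 0"
  then have "quad u x \<le> quad t (x - x)"
    by (rule short_le_translate)
  with u.quad_nonneg[of x] show "quad u x = 0"
    by (simp add: quad_def t.zero_left)
qed

lemma short_maximal:
  assumes "is_form a" and "form_le a t" and "form_absolutely_continuous a w"
  shows "form_le a u"
proof -
  interpret a: nonneg_form a by unfold_locales fact
  have "quad a x \<le> quad t (x - g)" if "quad w g = 0" for x g
    using assms(2,3) that a.quad_diff_null[of g x]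
    by (simp add: form_le_def form_absolutely_continuous_def) metis
  then show ?thesis
    by (simp add: form_le_def short_greatest)
qed

lemma le_of_le_remainder_add:
  assumes "is_form s" and "is_form v"
    and "form_le s w" and "form_absolutely_continuous v w"
    and le: "\<And>x. quad s x \<le> quad t x - quad u x + quad v x"
  shows "form_le s v"
proof -
  interpret s: nonneg_form s by unfold_locales fact
  interpret v: nonneg_form v by unfold_locales fact
  \<comment> \<open>\<open>s\<close>, \<open>u\<close> and \<open>v\<close> vanish on ker w, so
    passing to \<open>x - g\<close> changes the \<open>t\<close> term only; the infimum over
    \<open>g\<close> then turns that term into \<open>quad u x\<close>, which cancels.\<close>
  have "quad s x + quad u x - quad v x \<le> quad t (x - g)" if g: "quad w g = 0" for x g
  proof -
    have "quad s g = 0"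
      using assms(3) g s.quad_nonneg[of g] unfolding form_le_def by (metis order_antisym)
    moreover have "quad u g = 0" "quad v g = 0"
      using short_absolutely_continuous assms(4) g by (auto simp: form_absolutely_continuous_def)
    ultimately show ?thesis
      using le[of "x - g"] by (simp add: s.quad_diff_null u.quad_diff_null v.quad_diff_null)
  qed
  then have "quad s x + quad u x - quad v x \<le> quad u x" for x
    by (rule short_greatest)
  then show ?thesis
    by (simp add: form_le_def)
qed

lemma remainder_singular: "form_singular (\<lambda>x y. t x y - u x y) w"
  unfolding form_singular_def
proof (intro allI impI)
  fix s :: "'v form"
  assume s: "is_form s \<and> form_le s (\<lambda>x y. t x y - u x y) \<and> form_le s w"
  then interpret s: nonneg_form s by unfold_locales auto
  have "is_form (\<lambda>x y :: 'v. 0)"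
    by (simp add: is_form_def)
  then have "form_le s (\<lambda>x y. 0)"
    by (rule le_of_le_remainder_add[OF s.is_form])
      (use s in \<open>auto simp: form_le_def form_absolutely_continuous_def quad_diff_form
        quad_def[of "\<lambda>x y. 0"]\<close>)
  then show "s = (\<lambda>x y. 0)"
    using s.quad_nonneg by (intro s.eq_zeroI) (simp add: form_le_def quad_def[of "\<lambda>x y. 0"] order_antisym)
qed

end

section \<open>Rank-one forms\<close>

definition rank_one :: "('v \<Rightarrow> complex) \<Rightarrow> 'v form" where
  "rank_one \<phi> x y = \<phi> x * cnj (\<phi> y)"

definition clinear_functional :: "('v::complex_vector \<Rightarrow> complex) \<Rightarrow> bool" where
  "clinear_functional \<phi> \<longleftrightarrow>
     (\<forall>x y. \<phi> (x + y) = \<phi> x + \<phi> y) \<and> (\<forall>c x. \<phi> (c *\<^sub>C x) = c * \<phi> x)"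

lemma quad_rank_one: "quad (rank_one \<phi>) x = (cmod (\<phi> x))\<^sup>2"
  by (simp add: quad_def rank_one_def complex_mult_cnj cmod_power2)

lemma is_form_rank_one: "clinear_functional \<phi> \<Longrightarrow> is_form (rank_one \<phi>)"
  by (auto simp: is_form_def clinear_functional_def rank_one_def algebra_simps complex_mult_cnj
      complex_nonneg_Reals_iff)

text \<open>The kernel of \<phi> has codimension one and \<open>s\<close> vanishes on it, so
  \<open>quad s\<close> is a multiple of \<open>quad (rank_one \<phi>)\<close>. A positive factor
  could be divided out of \<open>form_le s w\<close>, making \<phi>
  \<open>w\<close>-bounded.\<close>

lemma form_below_rank_one_eq_zero:
  fixes s w :: "'v::complex_vector form"
  assumes "clinear_functional \<phi>" and "is_form s"
    and "form_le s (rank_one \<phi>)" and "form_le s w"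
    and unbounded: "\<not> form_dominated (rank_one \<phi>) w"
  shows "s = (\<lambda>x y. 0)"
proof -
  interpret s: nonneg_form s by unfold_locales fact
  have add: "\<phi> (x + y) = \<phi> x + \<phi> y" and scale: "\<phi> (c *\<^sub>C x) = c * \<phi> x" for x y c
    using assms(1) by (auto simp: clinear_functional_def)
  have le: "quad s x \<le> (cmod (\<phi> x))\<^sup>2" for x
    using assms(3) by (simp add: form_le_def quad_rank_one)
  obtain z where z: "\<phi> z \<noteq> 0"
  proof (rule ccontr)
    assume "\<not> thesis"
    with that have "\<phi> x = 0" for x by blast
    then have "form_dominated (rank_one \<phi>) w"
      unfolding form_dominated_def by (intro exI[of _ 0]) (simp add: quad_rank_one)
    with unbounded show False by simp
  qed
  have eq: "quad s x = (cmod (\<phi> x))\<^sup>2 * (quad s z / (cmod (\<phi> z))\<^sup>2)" for x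
  proof -
    \<comment> \<open>\<open>\<phi> k = 0\<close>, so \<open>s\<close> sees only the multiple of
      \<open>z\<close>.\<close>
    define k where "k = x - (\<phi> x / \<phi> z) *\<^sub>C z"
    have x: "x = (\<phi> x / \<phi> z) *\<^sub>C z + k"
      by (simp add: k_def)
    have "\<phi> x = \<phi> x + \<phi> k"
      by (subst x) (simp add: add scale z)
    then have "quad s k = 0"
      using le[of k] s.quad_nonneg[of k] by simp
    then have "quad s x = quad s ((\<phi> x / \<phi> z) *\<^sub>C z)"
      using s.quad_diff_null[of k x] by (simp add: k_def)
    then show ?thesis
      by (simp add: s.quad_scaleC norm_divide power_divide)
  qed
  have "quad s z = 0"
  proof (rule ccontr)
    assume "quad s z \<noteq> 0"
    then have pos: "quad s z > 0"
      using s.quad_nonneg[of z] by simp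
    have "(cmod (\<phi> x))\<^sup>2 \<le> (cmod (\<phi> z))\<^sup>2 / quad s z * quad w x" for x
    proof -
      have "quad s x \<le> quad w x"
        using assms(4) by (simp add: form_le_def)
      then show ?thesis
        using pos z unfolding eq[of x] by (simp add: field_simps)
    qed
    then have "form_dominated (rank_one \<phi>) w"
      unfolding form_dominated_def quad_rank_one by blast
    with unbounded show False by simp
  qed
  then have "quad s x = 0" for x
    using eq[of x] by simp
  then show ?thesis
    by (rule s.eq_zeroI)
qed

text \<open>
  This is a uniform boundedness principle for the functionals of the form \<open>t\<close>, proved by a
  gliding hump so that \<open>t\<close> need not be completed: if all \<open>t _ y\<close> are \<open>w\<close>-bounded, then
  \<open>\<Sum>k. (1/4)^k * t _ (x k)\<close> is not, provided that \<open>t (x n) (x n) = 1\<close>, that \<open>w (x n) (x n)\<close>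
  decreases fast, and that \<open>t (x n) (x k)\<close> is small for \<open>k < n\<close>.
\<close>

lemma exists_unbounded_functional:
  fixes t w :: "'v::complex_vector form"
  assumes "is_form t" and "is_form w"
    and ac: "form_absolutely_continuous t w" and "\<not> form_dominated t w"
  shows "\<exists>\<phi> D. clinear_functional \<phi> \<and> 0 < D \<and> (\<forall>x. (cmod (\<phi> x))\<^sup>2 \<le> D * quad t x) \<and>
           \<not> form_dominated (rank_one \<phi>) w"
proof (cases "\<exists>y. \<not> form_dominated (rank_one (\<lambda>x. t x y)) w")
  case True
  interpret t: nonneg_form t by unfold_locales fact
  from True obtain y where "\<not> form_dominated (rank_one (\<lambda>x. t x y)) w" ..
  \<comment> \<open>The summand 1 makes the constant positive.\<close>
  moreover have "(cmod (t x y))\<^sup>2 \<le> (quad t y + 1) * quad t x" for x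
    using t.Cauchy_Schwarz[of x y] t.quad_nonneg[of x] by (simp add: algebra_simps)
  moreover have "clinear_functional (\<lambda>x. t x y)"
    by (simp add: clinear_functional_def t.add_left t.scaleC_left)
  moreover have "quad t y + 1 > 0"
    using t.quad_nonneg[of y] by simp
  ultimately show ?thesis
    by blast
next
  case False
  interpret t: nonneg_form t by unfold_locales fact
  interpret w: nonneg_form w by unfold_locales fact
  from False obtain C where C: "\<And>x y. (cmod (t x y))\<^sup>2 \<le> C y * quad w x"
    unfolding form_dominated_def quad_rank_one by metis
  \<comment> \<open>Rescale a vector violating domination with constant
    \<open>1 / \<epsilon>\<close>.\<close>
  have small: "\<exists>x. quad t x = 1 \<and> quad w x \<le> \<epsilon>" if "\<epsilon> > 0" for \<epsilon>
  proof -
    obtain x where x: "quad t x > (1 / \<epsilon>) * quad w x"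
      using assms(4) unfolding form_dominated_def by (metis not_le)
    then have pos: "quad t x > 0"
      using w.quad_nonneg[of x] that by (smt (verit) divide_nonneg_pos mult_nonneg_nonneg)
    define c where "c = complex_of_real (1 / sqrt (quad t x))"
    have c: "(cmod c)\<^sup>2 = 1 / quad t x"
      using pos by (simp add: c_def norm_divide power_divide)
    have "quad t (c *\<^sub>C x) = 1" "quad w (c *\<^sub>C x) \<le> \<epsilon>"
      using pos that x by (auto simp: t.quad_scaleC w.quad_scaleC c field_simps)
    then show ?thesis
      by blast
  qed
  \<comment> \<open>A stage is a vector with a constant bounding the functional
    \<open>t _ (fst p)\<close>. \<open>Q\<close> makes the constants increase, so smallness of the
    next vector against the current constant also controls it against all earlier vectors. As 1/64
    is less than (1/4)^2, the values of \<open>quad w\<close> decay faster than the squared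
    humps.\<close>
  define P where "P n p \<longleftrightarrow> quad t (fst p) = 1 \<and> quad w (fst p) \<le> (1/64)^n \<and>
      (\<forall>x. (cmod (t x (fst p)))\<^sup>2 \<le> snd p * quad w x) \<and> 0 < snd p" for n and p :: "'v \<times> real"
  define Q where "Q n p p' \<longleftrightarrow> snd p \<le> snd p' \<and> snd p * quad w (fst p') \<le> ((1/4)^Suc n / 4)\<^sup>2"
    for n and p p' :: "'v \<times> real"
  have "\<exists>f. \<forall>n. P n (f n) \<and> Q n (f n) (f (Suc n))"
  proof (rule dependent_nat_choice)
    obtain x where x: "quad t x = 1" "quad w x \<le> 1"
      using small[of 1] by auto
    have "(cmod (t z x))\<^sup>2 \<le> max 1 (C x) * quad w z" for z
      by (rule order_trans[OF C]) (intro mult_right_mono, auto simp: w.quad_nonneg)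
    with x have "P 0 (x, max 1 (C x))"
      by (simp add: P_def)
    then show "\<exists>p. P 0 p" ..
  next
    fix p n assume p: "P n p"
    then have D: "snd p > 0"
      by (simp add: P_def)
    obtain x where x: "quad t x = 1"
      "quad w x \<le> min ((1/64)^Suc n) (((1/4)^Suc n / 4)\<^sup>2 / snd p)"
      using small[of "min ((1/64)^Suc n) (((1/4)^Suc n / 4)\<^sup>2 / snd p)"] D by auto
    have "(cmod (t z x))\<^sup>2 \<le> max (snd p) (C x) * quad w z" for z
      by (rule order_trans[OF C]) (intro mult_right_mono, auto simp: w.quad_nonneg)
    with x D have "P (Suc n) (x, max (snd p) (C x))"
      by (simp add: P_def)
    moreover have "snd p * quad w x \<le> ((1/4)^Suc n / 4)\<^sup>2"
      using x(2) D by (simp add: pos_le_divide_eq mult.commute)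
    then have "Q n p (x, max (snd p) (C x))"
      by (simp add: Q_def)
    ultimately show "\<exists>p'. P (Suc n) p' \<and> Q n p p'"
      by blast
  qed
  then obtain f where f: "\<And>n. P n (f n)" "\<And>n. Q n (f n) (f (Suc n))"
    by blast
  define X where "X n = fst (f n)" for n
  define B where "B n = snd (f n)" for n
  have tX: "quad t (X n) = 1" and wX: "quad w (X n) \<le> (1/64)^n"
    and BX: "(cmod (t x (X n)))\<^sup>2 \<le> B n * quad w x" for n x
    using f(1)[of n] by (auto simp: P_def X_def B_def)
  have B_mono: "B k \<le> B n" if "k \<le> n" for k n
  proof (rule lift_Suc_mono_le[OF _ that])
    show "B n \<le> B (Suc n)" for n
      using f(2)[of n] by (simp add: Q_def B_def)
  qed
  have off_diag: "cmod (t (X n) (X k)) \<le> (1/4)^n / 4" if "k < n" for k n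
  proof -
    from that obtain m where m: "n = Suc m" "k \<le> m"
      by (cases n) auto
    have "(cmod (t (X n) (X k)))\<^sup>2 \<le> B k * quad w (X n)"
      by (rule BX)
    also have "\<dots> \<le> B m * quad w (X n)"
      using B_mono[OF m(2)] by (intro mult_right_mono w.quad_nonneg)
    also have "\<dots> \<le> ((1/4)^n / 4)\<^sup>2"
      using f(2)[of m] by (simp add: Q_def B_def X_def m(1))
    finally show ?thesis
      by (rule power2_le_imp_le) simp
  qed
  define a where "a x k = (1/4)^k * t x (X k)" for x k
  have t_le: "cmod (t x (X k)) \<le> sqrt (quad t x)" for x k
    using t.Cauchy_Schwarz[of x "X k"] by (simp add: tX real_le_rsqrt)
  have norm_a: "cmod (a x k) \<le> (1/4)^k * sqrt (quad t x)" for x k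
    using t_le[of x k] by (simp add: a_def norm_mult norm_power mult_left_mono)
  have geo: "summable (\<lambda>k. (1/4)^k :: real)"
    by (simp add: summable_geometric)
  have sum_na: "summable (\<lambda>k. cmod (a x k))" for x
    by (rule summable_comparison_test'[OF summable_mult2[OF geo]]) (use norm_a in auto)
  then have sum_a: "summable (a x)" for x
    by (rule summable_norm_cancel)
  define \<phi> where "\<phi> x = suminf (a x)" for x
  \<comment> \<open>The factor 4/3 is the sum of the powers (1/4)^k; its square is the
    \<open>D\<close> chosen at the end.\<close>
  have bound: "cmod (\<phi> x) \<le> 4/3 * sqrt (quad t x)" for x
  proof -
    have "cmod (\<phi> x) \<le> (suminf (\<lambda>k. cmod (a x k)))"
      unfolding \<phi>_def by (rule summable_norm[OF sum_na])
    also have "\<dots> \<le> (suminf (\<lambda>k. (1/4)^k * sqrt (quad t x)))"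
      by (intro suminf_le norm_a sum_na summable_mult2[OF geo])
    also have "\<dots> = 4/3 * sqrt (quad t x)"
      by (simp add: suminf_mult2[OF geo, symmetric] suminf_geometric)
    finally show ?thesis .
  qed
  have "clinear_functional \<phi>"
    unfolding clinear_functional_def
  proof (intro conjI allI)
    show "\<phi> (x + y) = \<phi> x + \<phi> y" for x y
      unfolding \<phi>_def suminf_add[OF sum_a sum_a]
      by (simp add: a_def[abs_def] t.add_left algebra_simps)
    show "\<phi> (c *\<^sub>C x) = c * \<phi> x" for c x
      unfolding \<phi>_def suminf_mult[OF sum_a, symmetric]
      by (simp add: a_def[abs_def] t.scaleC_left algebra_simps)
  qed
  moreover have "(cmod (\<phi> x))\<^sup>2 \<le> 16/9 * quad t x" for x
    using power_mono[OF bound[of x], of 2] by (simp add: power_mult_distrib t.quad_nonneg power_divide)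
  \<comment> \<open>The term with index \<open>n\<close> has modulus (1/4)^n. Later terms add up to
    at most a third of that by \<open>norm_a\<close>, and so do earlier ones by
    \<open>off_diag\<close>; a third survives.\<close>
  moreover have hump: "cmod (\<phi> (X n)) \<ge> (1/4)^n / 3" for n
  proof -
    let ?a = "a (X n)"
    have split: "\<phi> (X n) = (suminf (\<lambda>k. ?a (k + Suc n))) + ((\<Sum>k<n. ?a k) + ?a n)"
      unfolding \<phi>_def by (subst suminf_split_initial_segment[OF sum_a, of _ "Suc n"]) simp
    have diag: "cmod (?a n) = (1/4)^n"
      by (simp add: a_def t.self_eq_quad tX norm_power)
    have "cmod (suminf (\<lambda>k. ?a (k + Suc n))) \<le> (suminf (\<lambda>k. cmod (?a (k + Suc n))))"
      using sum_na[of "X n"] by (intro summable_norm) (subst summable_iff_shift)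
    also have "\<dots> \<le> (suminf (\<lambda>k. (1/4)^k * (1/4)^Suc n))"
    proof (rule suminf_le)
      show "cmod (?a (k + Suc n)) \<le> (1/4)^k * (1/4)^Suc n" for k
        using norm_a[of "X n" "k + Suc n"] by (simp add: tX power_add)
      show "summable (\<lambda>k. cmod (?a (k + Suc n)))"
        using sum_na[of "X n"] by (subst summable_iff_shift)
    qed (rule summable_mult2[OF geo])
    also have "\<dots> = (1/4)^n / 3"
      by (subst suminf_mult2[OF geo, symmetric]) (simp add: suminf_geometric)
    finally have tail: "cmod (suminf (\<lambda>k. ?a (k + Suc n))) \<le> (1/4)^n / 3" .
    have "cmod (\<Sum>k<n. ?a k) \<le> (\<Sum>k<n. (1/4)^k * ((1/4)^n / 4))"
    proof (rule sum_norm_le)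
      fix k assume "k \<in> {..<n}"
      then show "cmod (?a k) \<le> (1/4)^k * ((1/4)^n / 4)"
        using off_diag[of k n] by (simp add: a_def norm_mult norm_power mult_left_mono)
    qed
    also have "\<dots> = (\<Sum>k<n. (1/4)^k) * ((1/4)^n / 4)"
      by (simp add: sum_distrib_right)
    also have "\<dots> \<le> 4/3 * ((1/4)^n / 4)"
      by (intro mult_right_mono) (auto simp: sum_gp_strict)
    finally have head: "cmod (\<Sum>k<n. ?a k) \<le> (1/4)^n / 3"
      by simp
    have "?a n = \<phi> (X n) - ((suminf (\<lambda>k. ?a (k + Suc n))) + (\<Sum>k<n. ?a k))"
      by (simp add: split)
    also have "cmod \<dots> \<le> cmod (\<phi> (X n)) + (cmod (suminf (\<lambda>k. ?a (k + Suc n))) + cmod (\<Sum>k<n. ?a k))"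
      by (rule order_trans[OF norm_triangle_ineq4 add_left_mono[OF norm_triangle_ineq]])
    finally have "cmod (?a n) \<le> cmod (\<phi> (X n)) + (cmod (suminf (\<lambda>k. ?a (k + Suc n))) + cmod (\<Sum>k<n. ?a k))" .
    with diag tail head show ?thesis
      by simp
  qed
  have "\<not> form_dominated (rank_one \<phi>) w"
  proof
    assume "form_dominated (rank_one \<phi>) w"
    then obtain c where c: "\<And>x. (cmod (\<phi> x))\<^sup>2 \<le> c * quad w x"
      unfolding form_dominated_def quad_rank_one by blast
    \<comment> \<open>The squared hump is at least (1/16)^n / 9 while \<open>quad w (X n)\<close> is
      at most (1/64)^n, so the constant would have to outgrow 4^n.\<close>
    have "4 ^ n \<le> 9 * max 0 c" for n
    proof -
      have "((1/4)^n / 3)\<^sup>2 \<le> (cmod (\<phi> (X n)))\<^sup>2"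
        by (intro power_mono hump) simp
      also have "\<dots> \<le> max 0 c * quad w (X n)"
        by (rule order_trans[OF c]) (intro mult_right_mono, auto simp: w.quad_nonneg)
      also have "\<dots> \<le> max 0 c * (1/64)^n"
        by (intro mult_left_mono wX) simp
      finally have "((1/4)^n)\<^sup>2 * 64^n \<le> 9 * max 0 c * ((1/64)^n * 64^n)"
        by (simp add: power_divide field_simps)
      moreover have "((1/4::real)^n)\<^sup>2 * 64^n = 4^n"
        by (simp add: power_mult_distrib[symmetric] power2_eq_square)
      moreover have "(1/64::real)^n * 64^n = 1"
        by (simp add: power_mult_distrib[symmetric])
      ultimately show ?thesis
        by simp
    qed
    moreover obtain n where "9 * max 0 c < 4 ^ n"
      using real_arch_pow[of 4 "9 * max 0 c"] by auto
    ultimately show False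
      by (meson not_le)
  qed
  ultimately show ?thesis
    by (intro exI[of _ \<phi>] exI[of _ "16/9"]) auto
qed

section \<open>Kernels\<close>

text \<open>Common finite index sets make the sums for different arguments comparable term by term;
  the support of a sum may be smaller than the union of the supports.\<close>

lemma kernel_form_superset:
  assumes "finite S" "finite T" "Poly_Mapping.keys g \<subseteq> S" "Poly_Mapping.keys f \<subseteq> T"
    and "\<And>s t. K s t \<in> dual_operators"
  shows "kernel_form K f g =
    (\<Sum>s\<in>S. \<Sum>t\<in>T. blinfun_apply (blinfun_apply (K s t) (Poly_Mapping.lookup g s)) (Poly_Mapping.lookup f t))"
proof -
  have "kernel_form K f g = (\<Sum>s\<in>Poly_Mapping.keys g. \<Sum>t\<in>T.
      blinfun_apply (blinfun_apply (K s t) (Poly_Mapping.lookup g s)) (Poly_Mapping.lookup f t))"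
    unfolding kernel_form_def pairing_def using assms
    by (intro sum.cong refl sum.mono_neutral_left) (auto simp: in_keys_iff blinfun.zero_right)
  also have "\<dots> = (\<Sum>s\<in>S. \<Sum>t\<in>T.
      blinfun_apply (blinfun_apply (K s t) (Poly_Mapping.lookup g s)) (Poly_Mapping.lookup f t))"
    using assms
    by (intro sum.mono_neutral_left) (auto simp: in_keys_iff blinfun.zero_right blinfun.zero_left)
  finally show ?thesis .
qed

text \<open>Functions supported at one point recover the operators from the form, which gives
  injectivity of \<open>kernel_form\<close>.\<close>

lemma kernel_form_single:
  "kernel_form K (Poly_Mapping.single t x) (Poly_Mapping.single s y) = pairing x (blinfun_apply (K s t) y)"
  by (simp add: kernel_form_def pairing_def blinfun.zero_right blinfun.zero_left)

lemma kernel_form_add: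
  "kernel_form (\<lambda>s t. A s t + B s t) f g = kernel_form A f g + kernel_form B f g"
  by (simp add: kernel_form_def pairing_def blinfun.add_left sum.distrib)

lemma kernel_form_inject: "kernel_form A = kernel_form B \<Longrightarrow> A = B"
  by (intro ext blinfun_eqI) (metis kernel_form_single pairing_def)

lemma lookup_scaleC: "Poly_Mapping.lookup (c *\<^sub>C f) s = c *\<^sub>C Poly_Mapping.lookup f s"
  by transfer simp

lemma is_form_kernel_form:
  assumes "is_kernel K"
  shows "is_form (kernel_form K)"
proof -
  have ops: "K s t \<in> dual_operators" for s t
    using assms by (simp add: is_kernel_def)
  have lin: "blinfun_apply (blinfun_apply (K s t) y) (c *\<^sub>C x) = c * blinfun_apply (blinfun_apply (K s t) y) x"
    and antilin: "blinfun_apply (blinfun_apply (K s t) (c *\<^sub>C y)) x = cnj c * blinfun_apply (blinfun_apply (K s t) y) x"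
    for s t c x y
    using ops[of s t]
    by (simp_all add: dual_operators_def topological_dual_def dual_scale_def blinfun_mult_right.rep_eq)
  have keys: "Poly_Mapping.keys (c *\<^sub>C f) \<subseteq> Poly_Mapping.keys f" for c and f :: "'a \<Rightarrow>\<^sub>0 'b"
    by (auto simp: in_keys_iff lookup_scaleC)
  show ?thesis
    unfolding is_form_def
  proof (intro conjI allI)
    fix f g h :: "'a \<Rightarrow>\<^sub>0 'b" and c :: complex
    define U where "U = Poly_Mapping.keys f \<union> Poly_Mapping.keys g \<union> Poly_Mapping.keys h"
    have U: "finite U" "Poly_Mapping.keys f \<subseteq> U" "Poly_Mapping.keys g \<subseteq> U" "Poly_Mapping.keys h \<subseteq> U"
      "Poly_Mapping.keys (f + g) \<subseteq> U" "Poly_Mapping.keys (g + h) \<subseteq> U"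
      "Poly_Mapping.keys (c *\<^sub>C f) \<subseteq> U" "Poly_Mapping.keys (c *\<^sub>C h) \<subseteq> U"
      using Poly_Mapping.keys_add[of f g] Poly_Mapping.keys_add[of g h] keys[of c f] keys[of c h]
      by (auto simp: U_def)
    note expand = kernel_form_superset[OF U(1) U(1) _ _ ops]
    show "kernel_form K (f + g) h = kernel_form K f h + kernel_form K g h"
      using U by (simp add: expand lookup_add blinfun.add_right sum.distrib)
    show "kernel_form K (c *\<^sub>C f) h = c * kernel_form K f h"
      using U by (simp add: expand lookup_scaleC lin sum_distrib_left)
    show "kernel_form K f (g + h) = kernel_form K f g + kernel_form K f h"
      using U by (simp add: expand lookup_add blinfun.add_right blinfun.add_left sum.distrib)
    show "kernel_form K f (c *\<^sub>C h) = cnj c * kernel_form K f h"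
      using U by (simp add: expand lookup_scaleC antilin sum_distrib_left)
    show "kernel_form K f f \<in> \<real>\<^sub>\<ge>\<^sub>0"
      using assms by (simp add: is_kernel_def)
  qed
qed

section \<open>Representing forms by kernels\<close>

lemma single_scaleC:
  "Poly_Mapping.single s (c *\<^sub>C x) = c *\<^sub>C Poly_Mapping.single s (x :: 'e::complex_vector)"
  by (rule poly_mapping_eqI) (simp add: lookup_scaleC lookup_single when_def)

lemma sum_single_lookup:
  "(\<Sum>s\<in>Poly_Mapping.keys f. Poly_Mapping.single s (Poly_Mapping.lookup f s)) = f"
  by (rule poly_mapping_eqI)
    (simp add: Poly_Mapping.lookup_sum lookup_single when_def sum.delta in_keys_iff)

text \<open>The values of \<open>u\<close> on functions supported at one point dictate the
  operators. These are bounded because \<open>u\<close> lies below the form of \<open>K\<close> on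
  such functions, by Cauchy-Schwarz; splitting arguments into one-point pieces recovers
  \<open>u\<close>.\<close>

lemma kernel_of_form:
  fixes K :: "('s, 'e::complex_banach) operator_function"
  assumes "is_kernel K" and "is_form u" and le: "form_le u (kernel_form K)"
  shows "\<exists>A. is_kernel A \<and> kernel_form A = u"
proof -
  interpret u: nonneg_form u by unfold_locales fact
  let ?\<delta> = "Poly_Mapping.single :: 's \<Rightarrow> 'e \<Rightarrow> _"
  \<comment> \<open>\<open>y\<close> is the argument of the operator and \<open>x\<close> that of
    the resulting functional, so \<open>x\<close> takes the linear slot of \<open>u\<close>.\<close>
  define b where "b s t y x = u (?\<delta> t x) (?\<delta> s y)" for s t y x
  have quad_single: "quad u (?\<delta> s y) \<le> norm (K s s) * (norm y)\<^sup>2" for s y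
  proof -
    have "quad u (?\<delta> s y) \<le> quad (kernel_form K) (?\<delta> s y)"
      using le by (simp add: form_le_def)
    also have "\<dots> \<le> cmod (pairing y (blinfun_apply (K s s) y))"
      unfolding quad_def kernel_form_single by (rule complex_Re_le_cmod)
    also have "\<dots> \<le> norm (blinfun_apply (K s s) y) * norm y"
      unfolding pairing_def by (rule norm_blinfun)
    also have "\<dots> \<le> norm (K s s) * norm y * norm y"
      by (intro mult_right_mono norm_blinfun) simp
    finally show ?thesis
      by (simp add: power2_eq_square mult.assoc)
  qed
  have b_bound: "cmod (b s t y x) \<le> (sqrt (norm (K s s)) * sqrt (norm (K t t))) * norm y * norm x"
    for s t y x
  proof (rule power2_le_imp_le)
    have "(cmod (b s t y x))\<^sup>2 \<le> quad u (?\<delta> t x) * quad u (?\<delta> s y)"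
      unfolding b_def by (rule u.Cauchy_Schwarz)
    also have "\<dots> \<le> (norm (K t t) * (norm x)\<^sup>2) * (norm (K s s) * (norm y)\<^sup>2)"
      by (intro mult_mono quad_single u.quad_nonneg) simp
    also have "\<dots> = (sqrt (norm (K s s)) * sqrt (norm (K t t)) * norm y * norm x)\<^sup>2"
      by (simp add: power_mult_distrib)
    finally show "(cmod (b s t y x))\<^sup>2 \<le> \<dots>" .
  qed simp
  \<comment> \<open>\<open>Blinfun\<close> requires real linearity, so real scalars are read as
    complex ones; complex linearity and antilinearity are checked afterwards for
    \<open>dual_operators\<close>.\<close>
  have real_scale: "r *\<^sub>R x = complex_of_real r *\<^sub>C x" for r and x :: 'e
    by (simp add: scaleC_of_real)
  have b_lin: "bounded_linear (b s t y)" for s t y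
    unfolding b_def[abs_def]
    using b_bound[of s t y, unfolded b_def]
    by (intro bounded_linear_intro[where K = "sqrt (norm (K s s)) * sqrt (norm (K t t)) * norm y"])
      (auto simp: single_add u.add_left real_scale single_scaleC u.scaleC_left scaleR_conv_of_real
        algebra_simps)
  have Blin: "bounded_linear (\<lambda>y. Blinfun (b s t y))" for s t
  proof (rule bounded_linear_intro[where K = "sqrt (norm (K s s)) * sqrt (norm (K t t))"])
    show "Blinfun (b s t (x + y)) = Blinfun (b s t x) + Blinfun (b s t y)" for x y
      by (rule blinfun_eqI)
        (simp add: bounded_linear_Blinfun_apply b_lin blinfun.add_left, simp add: b_def single_add u.add_right)
    show "Blinfun (b s t (r *\<^sub>R x)) = r *\<^sub>R Blinfun (b s t x)" for r x
      by (rule blinfun_eqI)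
        (simp add: bounded_linear_Blinfun_apply b_lin blinfun.scaleR_left,
         simp add: b_def real_scale single_scaleC u.scaleC_right scaleR_conv_of_real)
    show "norm (Blinfun (b s t y)) \<le> norm y * (sqrt (norm (K s s)) * sqrt (norm (K t t)))" for y
      using b_bound[of s t y]
      by (intro norm_blinfun_bound) (auto simp: bounded_linear_Blinfun_apply b_lin algebra_simps)
  qed
  define A where "A s t = Blinfun (\<lambda>y. Blinfun (b s t y))" for s t
  have A: "blinfun_apply (blinfun_apply (A s t) y) x = u (?\<delta> t x) (?\<delta> s y)" for s t y x
    by (simp add: A_def bounded_linear_Blinfun_apply Blin b_lin) (simp add: b_def)
  have "kernel_form A f g = u f g" for f g
  proof -
    have "u f g = u (\<Sum>t\<in>Poly_Mapping.keys f. ?\<delta> t (Poly_Mapping.lookup f t))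
        (\<Sum>s\<in>Poly_Mapping.keys g. ?\<delta> s (Poly_Mapping.lookup g s))"
      by (simp only: sum_single_lookup)
    also have "\<dots> = kernel_form A f g"
      unfolding u.sum_left u.sum_right kernel_form_def pairing_def A ..
    finally show ?thesis ..
  qed
  then have kf: "kernel_form A = u"
    by blast
  moreover have "A s t \<in> dual_operators" for s t
    unfolding dual_operators_def topological_dual_def
    by (auto intro!: blinfun_eqI
        simp: A single_scaleC u.scaleC_left u.scaleC_right dual_scale_def blinfun_mult_right.rep_eq)
  ultimately show ?thesis
    by (intro exI[of _ A]) (simp add: is_kernel_def u.nonneg)
qed

text \<open>\<open>kernel_of_form\<close> represents the difference of the forms by some kernel, and
  injectivity identifies it with the pointwise difference.\<close>

lemma kernel_remainder:
  fixes K :: "('s, 'e::complex_banach) operator_function"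
  assumes "is_kernel K" and "is_kernel A" and "form_le (kernel_form A) (kernel_form K)"
  shows "is_kernel (\<lambda>s t. K s t - A s t)"
    and "kernel_form (\<lambda>s t. K s t - A s t) = (\<lambda>f g. kernel_form K f g - kernel_form A f g)"
proof -
  let ?u = "\<lambda>f g. kernel_form K f g - kernel_form A f g"
  interpret A: nonneg_form "kernel_form A"
    by unfold_locales (rule is_form_kernel_form[OF assms(2)])
  have "is_form ?u"
    by (intro is_form_diff is_form_kernel_form assms)
  moreover have "form_le ?u (kernel_form K)"
    by (simp add: form_le_def quad_diff_form A.quad_nonneg)
  ultimately obtain B where B: "is_kernel B" "kernel_form B = ?u"
    using kernel_of_form[OF assms(1)] by blast
  have "kernel_form (\<lambda>s t. A s t + B s t) = kernel_form K"
    by (simp add: fun_eq_iff kernel_form_add B(2))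
  then have "(\<lambda>s t. A s t + B s t) = K"
    by (rule kernel_form_inject)
  then have "(\<lambda>s t. K s t - A s t) = B"
    by auto
  with B show "is_kernel (\<lambda>s t. K s t - A s t)" "kernel_form (\<lambda>s t. K s t - A s t) = ?u"
    by simp_all
qed

section \<open>Existence and uniqueness of the decomposition\<close>

theorem theorem2p3:
  fixes K L :: "'s \<Rightarrow> 's \<Rightarrow> ('e::complex_banach \<Rightarrow>\<^sub>L 'e \<Rightarrow>\<^sub>L complex)"
  assumes "is_kernel K" and "is_kernel L"
  shows "(\<exists>!A. determines_ac_part K L A) \<and>
    short_type_decomposition K L (ac_part K L) (singular_part K L) \<and>
    ((\<exists>!(A, B). short_type_decomposition K L A B) \<longleftrightarrow> kernel_dominated (ac_part K L) L)"
proof -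
  let ?t = "kernel_form K" and ?w = "kernel_form L"
  note forms = is_form_kernel_form[OF assms(1)] is_form_kernel_form[OF assms(2)]
  interpret t: nonneg_form ?t by unfold_locales (rule forms)
  interpret w: nonneg_form ?w by unfold_locales (rule forms)
  obtain u where u: "is_form u" "\<And>x. quad u x = (INF g\<in>form_ker ?w. quad ?t (x - g))"
    using short_form_exists[OF forms] by blast
  interpret short_form ?t ?w u
    by unfold_locales (use u in auto)
  obtain U where U: "is_kernel U" "kernel_form U = u"
    using kernel_of_form[OF assms(1) u(1) short_le] by blast
  \<comment> \<open>Polarization and injectivity show that the diagonal values fix the
    kernel.\<close>
  have det: "determines_ac_part K L A \<longleftrightarrow> A = U" for A
  proof
    assume A: "determines_ac_part K L A"
    then have "kernel_form A = kernel_form U"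
      unfolding determines_ac_part_def U(2) u(2)[symmetric]
      by (intro form_eqI is_form_kernel_form u(1)) auto
    then show "A = U"
      by (rule kernel_form_inject)
  qed (simp add: determines_ac_part_def U u(2))
  then have ac_part: "ac_part K L = U"
    unfolding ac_part_def by (intro the_equality) auto
  have decomp: "short_type_decomposition K L A (\<lambda>s t. K s t - A s t)"
    if "is_kernel A" "form_le (kernel_form A) ?t" "form_absolutely_continuous (kernel_form A) ?w"
      "form_singular (\<lambda>f g. ?t f g - kernel_form A f g) ?w" for A
    using that kernel_remainder[OF assms(1) that(1,2)]
    by (simp add: short_type_decomposition_def kernel_absolutely_continuous_def kernel_singular_def)
  have main: "short_type_decomposition K L U (\<lambda>s t. K s t - U s t)"
    by (rule decomp) (simp_all add: U short_le short_absolutely_continuous remainder_singular)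
  have unique: "A = U \<and> B = (\<lambda>s t. K s t - U s t)"
    if dom: "form_dominated u ?w" and AB: "short_type_decomposition K L A B" for A B
  proof -
    from AB have A: "is_kernel A" and B: "is_kernel B" and K: "K = (\<lambda>s t. A s t + B s t)"
      and ac: "form_absolutely_continuous (kernel_form A) ?w"
      and sing: "form_singular (kernel_form B) ?w"
      by (auto simp: short_type_decomposition_def kernel_absolutely_continuous_def
          kernel_singular_def fun_eq_iff)
    interpret A: nonneg_form "kernel_form A" by unfold_locales (rule is_form_kernel_form[OF A])
    interpret B: nonneg_form "kernel_form B" by unfold_locales (rule is_form_kernel_form[OF B])
    have quad_K: "quad ?t x = quad (kernel_form A) x + quad (kernel_form B) x" for x
      unfolding K by (simp add: quad_def kernel_form_add)
    have le: "form_le (kernel_form A) u"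
      by (rule short_maximal[OF A.is_form _ ac]) (simp add: form_le_def quad_K B.quad_nonneg)
    from dom obtain c where c: "\<And>x. quad u x \<le> c * quad ?w x"
      unfolding form_dominated_def by blast
    \<comment> \<open>\<open>d \<le> 1\<close> places the scaled difference of \<open>u\<close> and
      the form of \<open>A\<close> below the form of \<open>B\<close>; \<open>d * c \<le> 1\<close>
      places it below that of \<open>L\<close>. The maximum with 1 also covers
      \<open>c \<le> 0\<close>.\<close>
    define d where "d = 1 / max 1 c"
    have d: "0 < d" "d \<le> 1" "d * c \<le> 1"
      by (auto simp: d_def field_simps)
    define s where "s = (\<lambda>f g. of_real d * (u f g - kernel_form A f g))"
    have s: "is_form s"
      unfolding s_def using d by (intro is_form_scale is_form_diff u(1) A.is_form le) simp
    have quad_s: "quad s x = d * (quad u x - quad (kernel_form A) x)" for x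
      by (simp add: s_def quad_def)
    have "form_le s (kernel_form B)"
      unfolding form_le_def
    proof
      fix x
      have "quad s x \<le> 1 * (quad u x - quad (kernel_form A) x)"
        unfolding quad_s using le d by (intro mult_right_mono) (auto simp: form_le_def)
      also have "\<dots> \<le> quad (kernel_form B) x"
        using short_le quad_K[of x] by (auto simp: form_le_def dest!: spec[of _ x])
      finally show "quad s x \<le> quad (kernel_form B) x" .
    qed
    moreover have "form_le s ?w"
      unfolding form_le_def
    proof
      fix x
      have "quad s x \<le> d * (c * quad ?w x)"
        unfolding quad_s using d c[of x] A.quad_nonneg[of x] by (intro mult_left_mono) auto
      also have "\<dots> = d * c * quad ?w x"
        by simp
      also have "\<dots> \<le> 1 * quad ?w x"
        by (intro mult_right_mono d w.quad_nonneg)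
      finally show "quad s x \<le> quad ?w x"
        by simp
    qed
    ultimately have "s = (\<lambda>x y. 0)"
      using sing s by (simp add: form_singular_def)
    then have "kernel_form A = kernel_form U"
      using d(1) by (auto simp: s_def fun_eq_iff U(2))
    then have "A = U"
      by (rule kernel_form_inject)
    then show ?thesis
      by (auto simp: K)
  qed
  have other: "\<exists>A B. short_type_decomposition K L A B \<and> A \<noteq> U" if nd: "\<not> form_dominated u ?w"
  proof -
    obtain \<psi> D where \<psi>: "clinear_functional \<psi>" "0 < D" "\<And>x. (cmod (\<psi> x))\<^sup>2 \<le> D * quad u x"
      and \<psi>_unb: "\<not> form_dominated (rank_one \<psi>) ?w"
      using exists_unbounded_functional[OF u(1) forms(2) short_absolutely_continuous nd] by blast
    \<comment> \<open>Rescaling turns the bound \<open>D * quad u x\<close> into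
      \<open>quad u x\<close> and preserves unboundedness.\<close>
    define \<phi> where "\<phi> x = of_real (1 / sqrt D) * \<psi> x" for x
    have \<phi>_\<psi>: "(cmod (\<phi> x))\<^sup>2 = (cmod (\<psi> x))\<^sup>2 / D" for x
      using \<psi>(2) by (simp add: \<phi>_def norm_mult norm_divide power_mult_distrib power_divide)
    have \<phi>: "clinear_functional \<phi>"
      using \<psi>(1) by (simp add: clinear_functional_def \<phi>_def add_divide_distrib)
    have \<phi>_le: "form_le (rank_one \<phi>) u"
      using \<psi>(2,3) by (simp add: form_le_def quad_rank_one \<phi>_\<psi> field_simps)
    have \<phi>_unb: "\<not> form_dominated (rank_one \<phi>) ?w"
    proof
      assume "form_dominated (rank_one \<phi>) ?w"
      then obtain c where "\<And>x. (cmod (\<psi> x))\<^sup>2 / D \<le> c * quad ?w x"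
        by (auto simp: form_dominated_def quad_rank_one \<phi>_\<psi>)
      then have "(cmod (\<psi> x))\<^sup>2 \<le> (D * c) * quad ?w x" for x
        using \<psi>(2) by (simp add: field_simps)
      with \<psi>_unb show False
        unfolding form_dominated_def quad_rank_one by blast
    qed
    let ?r = "rank_one \<phi>"
    interpret r: nonneg_form ?r by unfold_locales (rule is_form_rank_one[OF \<phi>])
    define a where "a = (\<lambda>f g. u f g - ?r f g)"
    have a: "is_form a"
      unfolding a_def by (intro is_form_diff u(1) r.is_form \<phi>_le)
    have quad_a: "quad a x = quad u x - quad ?r x" for x
      by (simp add: a_def quad_diff_form)
    have a_le_u: "form_le a u"
      by (simp add: form_le_def quad_a r.quad_nonneg)
    then have a_le: "form_le a ?t"
      using short_le by (auto simp: form_le_def intro: order_trans)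
    obtain A where A: "is_kernel A" "kernel_form A = a"
      using kernel_of_form[OF assms(1) a a_le] by blast
    have r_ac: "form_absolutely_continuous ?r ?w"
      using short_absolutely_continuous \<phi>_le r.quad_nonneg
      unfolding form_absolutely_continuous_def form_le_def by (metis order_antisym)
    have "form_absolutely_continuous a ?w"
      using short_absolutely_continuous r_ac by (simp add: form_absolutely_continuous_def quad_a)
    moreover have "form_singular (\<lambda>f g. ?t f g - a f g) ?w"
      unfolding form_singular_def
    proof (intro allI impI)
      fix s assume s: "is_form s \<and> form_le s (\<lambda>f g. ?t f g - a f g) \<and> form_le s ?w"
      \<comment> \<open>Subtracting \<open>a\<close> from \<open>?t\<close> leaves the singular
        remainder plus \<open>?r\<close>, so the estimate applies with \<open>v\<close> taken to be
        \<open>?r\<close>.\<close>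
      have "form_le s ?r"
      proof (rule le_of_le_remainder_add[OF _ r.is_form _ r_ac])
        show "quad s x \<le> quad ?t x - quad u x + quad ?r x" for x
          using s by (simp add: form_le_def quad_diff_form quad_a algebra_simps)
      qed (use s in blast)+
      then show "s = (\<lambda>x y. 0)"
        using form_below_rank_one_eq_zero[OF \<phi> _ _ _ \<phi>_unb] s by blast
    qed
    ultimately have "short_type_decomposition K L A (\<lambda>s t. K s t - A s t)"
      using A a_le by (intro decomp) auto
    \<comment> \<open>Equality would force \<phi> to vanish, and the zero functional is dominated
      with constant 0.\<close>
    moreover have "A \<noteq> U"
    proof
      assume "A = U"
      then have "quad ?r x = 0" for x
        using quad_a[of x] A(2) U(2) by simp
      then have "form_dominated ?r ?w"
        unfolding form_dominated_def by (intro exI[of _ 0]) simp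
      with \<phi>_unb show False ..
    qed
    ultimately show ?thesis
      by blast
  qed
  have "(\<exists>!p. case p of (A, B) \<Rightarrow> short_type_decomposition K L A B) \<longleftrightarrow> form_dominated u ?w"
  proof
    assume ex1: "\<exists>!p. case p of (A, B) \<Rightarrow> short_type_decomposition K L A B"
    show "form_dominated u ?w"
    proof (rule ccontr)
      assume "\<not> form_dominated u ?w"
      from other[OF this] obtain A B where AB: "short_type_decomposition K L A B" "A \<noteq> U"
        by blast
      from ex1 obtain p
        where p: "\<And>q. (case q of (A, B) \<Rightarrow> short_type_decomposition K L A B) \<Longrightarrow> q = p"
        by (elim ex1E) blast
      from p[of "(A, B)"] p[of "(U, \<lambda>s t. K s t - U s t)"] AB main show False
        by simp
    qed
  next
    assume dom: "form_dominated u ?w"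
    show "\<exists>!p. case p of (A, B) \<Rightarrow> short_type_decomposition K L A B"
    proof (rule ex1I[of _ "(U, \<lambda>s t. K s t - U s t)"])
      show "p = (U, \<lambda>s t. K s t - U s t)"
        if "case p of (A, B) \<Rightarrow> short_type_decomposition K L A B" for p
        using unique[OF dom, of "fst p" "snd p"] that by (simp add: case_prod_beta prod_eq_iff)
    qed (simp add: main)
  qed
  moreover have "\<exists>!A. determines_ac_part K L A"
    by (rule ex1I[of _ U]) (simp_all only: det)
  ultimately show ?thesis
    using main unfolding kernel_dominated_def singular_part_def ac_part U(2) by blast
qed

end
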